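(* Let $k\ge 1$ be an integer. For each dimension $d\ge 1$ let $C_2(k,d)$ be the sharp (i.e. largest possible) constant $C$ such that $$\sum_{n\in\mathbb{Z}^d}|\Delta^k u(n)|^2\;\ge\;C\sum_{n\in\mathbb{Z}^d}\frac{|u(n)|^2}{|n|^{4k}}$$ holds for all finitely supported functions $u$ on $\mathbb{Z}^d$ with $u(0)=0$. Then $C_2(k,d)\sim d^{2k}$ as $d\to\infty$; that is, there exist positive constants $c_1,c_2$ and $N$, independent of $d$, such that $$c_1 d^{2k}\le C_2(k,d)\le c_2 d^{2k}\qquad\text{for all } d\ge N.$$
   Context: Functions on $\mathbb{Z}^d$ are complex-valued; $|n|$ is the Euclidean norm of $n\in\mathbb{Z}^d$; $e_1,\dots,e_d$ is the canonical basis of $\mathbb{R}^d$. $\Delta u(n):=\sum_{j=1}^d\big(2u(n)-u(n-e_j)-u(n+e_j)\big)$ and $\Delta^k$ is its $k$-fold iterate. In the right-hand sum the $n=0$ term is understood to be $0$ (as $u(0)=0$). *)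

theory Defs
  imports "HOL-Analysis.Analysis"
begin

text \<open>
  The dimension has to be an ordinary variable, since the constants of the theorem are uniform
  in it. So a point of \<open>\<int>\<^sup>d\<close> is a function on the naturals that vanishes from \<open>d\<close> on (coordinates
  are numbered from \<open>0\<close>), and a function on \<open>\<int>\<^sup>d\<close> is a function on this larger type of which only
  the values on \<open>lattice d\<close> matter.
\<close>

definition lattice :: "nat \<Rightarrow> (nat \<Rightarrow> int) set" where
  "lattice d = {n. \<forall>i\<ge>d. n i = 0}"

definition lattice_norm :: "nat \<Rightarrow> (nat \<Rightarrow> int) \<Rightarrow> real" where
  "lattice_norm d n = L2_set (\<lambda>i. real_of_int (n i)) {..<d}"

definition finitely_supported :: "nat \<Rightarrow> ((nat \<Rightarrow> int) \<Rightarrow> complex) \<Rightarrow> bool" where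
  "finitely_supported d u \<longleftrightarrow> finite {n \<in> lattice d. u n \<noteq> 0}"

text \<open>The sign is such that the Laplacian is nonnegative; \<open>n(j := n j \<plusminus> 1)\<close> is \<open>n \<plusminus> e\<^sub>j\<close>.\<close>

definition laplacian :: "nat \<Rightarrow> ((nat \<Rightarrow> int) \<Rightarrow> complex) \<Rightarrow> (nat \<Rightarrow> int) \<Rightarrow> complex" where
  "laplacian d u n = (\<Sum>j<d. 2 * u n - u (n(j := n j - 1)) - u (n(j := n j + 1)))"

text \<open>Both sums have only finitely many nonzero terms. For \<open>k \<ge> 1\<close> the term \<open>n = 0\<close> on the right
  is \<open>0 / 0 = 0\<close>.\<close>

definition hardy_rellich :: "nat \<Rightarrow> nat \<Rightarrow> real \<Rightarrow> bool" where
  "hardy_rellich k d C \<longleftrightarrow>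
     (\<forall>u. finitely_supported d u \<and> u (\<lambda>_. 0) = 0 \<longrightarrow>
        (\<Sum>\<^sub>\<infinity>n\<in>lattice d. (cmod ((laplacian d ^^ k) u n))\<^sup>2)
          \<ge> C * (\<Sum>\<^sub>\<infinity>n\<in>lattice d. (cmod (u n))\<^sup>2 / lattice_norm d n ^ (4 * k)))"

definition sharp_constant :: "nat \<Rightarrow> nat \<Rightarrow> real" where
  "sharp_constant k d = (GREATEST C. hardy_rellich k d C)"

text \<open>The greatest constant exists in every dimension \<open>d \<ge> 1\<close>.\<close>

lemma hardy_rellich_bounded:
  assumes "d \<ge> 1"
  shows "\<exists>B. \<forall>C. hardy_rellich k d C \<longrightarrow> C \<le> B"
proof -
  define e :: "nat \<Rightarrow> int" where "e = (\<lambda>i. if i = 0 then 1 else 0)"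
  define u :: "(nat \<Rightarrow> int) \<Rightarrow> complex" where "u = (\<lambda>n. if n = e then 1 else 0)"
  have e: "e \<in> lattice d" using assms by (auto simp: e_def lattice_def)
  have norm_e: "lattice_norm d e = 1"
  proof -
    have "(\<Sum>i<d. (real_of_int (e i))\<^sup>2) = (\<Sum>i<d. if i = 0 then 1 else 0)"
      by (intro sum.cong) (auto simp: e_def)
    also have "\<dots> = 1" using assms by (simp add: sum.delta)
    finally show ?thesis by (simp add: lattice_norm_def L2_set_def)
  qed
  have supp: "finitely_supported d u"
    by (simp add: finitely_supported_def u_def)
  have "e 0 \<noteq> 0" by (simp add: e_def)
  then have "u (\<lambda>_. 0) = 0" by (auto simp: u_def)
  moreover have "(\<Sum>\<^sub>\<infinity>n\<in>lattice d. (cmod (u n))\<^sup>2 / lattice_norm d n ^ (4 * k)) = 1"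
  proof -
    have "(\<Sum>\<^sub>\<infinity>n\<in>lattice d. (cmod (u n))\<^sup>2 / lattice_norm d n ^ (4 * k))
        = (\<Sum>\<^sub>\<infinity>n\<in>{e}. (cmod (u n))\<^sup>2 / lattice_norm d n ^ (4 * k))"
      using e by (intro infsum_cong_neutral) (auto simp: u_def)
    also have "\<dots> = 1" by (simp add: u_def norm_e)
    finally show ?thesis .
  qed
  ultimately have "C \<le> (\<Sum>\<^sub>\<infinity>n\<in>lattice d. (cmod ((laplacian d ^^ k) u n))\<^sup>2)"
    if "hardy_rellich k d C" for C
    using that supp unfolding hardy_rellich_def by fastforce
  then show ?thesis by blast
qed

lemma hardy_rellich_zero: "hardy_rellich k d 0"
  by (simp add: hardy_rellich_def infsum_nonneg)

lemma sharp_constant_greatest: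
  assumes "d \<ge> 1"
  shows "hardy_rellich k d (sharp_constant k d)"
    and "hardy_rellich k d C \<Longrightarrow> C \<le> sharp_constant k d"
proof -
  define S where "S = Sup {C. hardy_rellich k d C}"
  have bdd: "bdd_above {C. hardy_rellich k d C}"
    using hardy_rellich_bounded[OF assms, of k] by (auto simp: bdd_above_def)
  have upper: "C \<le> S" if "hardy_rellich k d C" for C
    unfolding S_def using that bdd by (auto intro: cSup_upper)
  have S: "hardy_rellich k d S"
    unfolding hardy_rellich_def
  proof (intro allI impI)
    fix u assume u: "finitely_supported d u \<and> u (\<lambda>_. 0) = 0"
    define L where "L = (\<Sum>\<^sub>\<infinity>n\<in>lattice d. (cmod ((laplacian d ^^ k) u n))\<^sup>2)"
    define R where "R = (\<Sum>\<^sub>\<infinity>n\<in>lattice d. (cmod (u n))\<^sup>2 / lattice_norm d n ^ (4 * k))"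
    have *: "C * R \<le> L" if "hardy_rellich k d C" for C
      using that u unfolding hardy_rellich_def L_def R_def by blast
    have "R \<ge> 0" unfolding R_def
      by (intro infsum_nonneg) (simp add: lattice_norm_def L2_set_nonneg)
    have "S * R \<le> L"
    proof (cases "R = 0")
      case True
      then show ?thesis using *[OF hardy_rellich_zero] by simp
    next
      case False
      with \<open>R \<ge> 0\<close> have "R > 0" by simp
      have "S \<le> L / R" unfolding S_def
      proof (rule cSup_least)
        show "{C. hardy_rellich k d C} \<noteq> {}" using hardy_rellich_zero by blast
        show "C \<le> L / R" if "C \<in> {C. hardy_rellich k d C}" for C
          using * that \<open>R > 0\<close> by (simp add: pos_le_divide_eq)
      qed
      then show ?thesis using \<open>R > 0\<close> by (simp add: pos_le_divide_eq)
    qed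
    then show "L \<ge> S * R" .
  qed
  have eq: "sharp_constant k d = S"
    unfolding sharp_constant_def using S upper by (rule Greatest_equality)
  show "hardy_rellich k d (sharp_constant k d)" using S eq by simp
  show "C \<le> sharp_constant k d" if "hardy_rellich k d C" using upper[OF that] eq by simp
qed

end

theory Submission imports Defs begin

text \<open>
  Upper bound: test with the indicator of a unit vector and use \<open>\<parallel>\<Delta>\<parallel> \<le> 4 d\<close>.

  Lower bound: put \<open>w(n) = 1 / (\<bar>n\<bar>\<^sup>2 + 3)\<close>. Summation by parts turns \<open>Re (cnj v\<^sub>n v\<^sub>m) \<le>
  (\<bar>v\<^sub>n\<bar>\<^sup>2 + \<bar>v\<^sub>m\<bar>\<^sup>2) / 2\<close> into \<open>2 Re \<langle>w\<^sup>s v, \<Delta> v\<rangle> \<ge> \<Sum> \<bar>v\<bar>\<^sup>2 \<Delta>(w\<^sup>s)\<close>. A second-order Taylor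
  estimate gives \<open>\<Delta>(w\<^sup>s) \<ge> (d / 2) w\<^sup>s\<^sup>+\<^sup>1\<close> once \<open>d\<close> is large: the drift contributes \<open>d\<close>, the convexity only a
  constant depending on \<open>s\<close>. With \<open>s = 2 i + 1\<close> and Cauchy-Schwarz,
  \<open>\<parallel>w\<^sup>i \<Delta> v\<parallel> \<ge> (d / 4) \<parallel>w\<^sup>i\<^sup>+\<^sup>1 v\<parallel>\<close>, which needs no condition at the origin and so can be
  iterated \<open>k\<close> times. Off the origin \<open>w\<close> is comparable to \<open>1 / \<bar>n\<bar>\<^sup>2\<close>.
\<close>

section \<open>Sums over the lattice and symmetry of the Laplacian\<close>

lemma has_sum_sum:
  fixes f :: "'i \<Rightarrow> 'a \<Rightarrow> 'b :: topological_comm_monoid_add"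
  assumes "finite I" and "\<And>i. i \<in> I \<Longrightarrow> (f i has_sum s i) A"
  shows "((\<lambda>x. \<Sum>i\<in>I. f i x) has_sum (\<Sum>i\<in>I. s i)) A"
  using assms by (induction I rule: finite_induct) (auto intro: has_sum_add)

lemma bij_betw_shift_lattice:
  assumes "j < d"
  shows "bij_betw (\<lambda>n. n(j := n j + c)) (lattice d) (lattice d)"
  by (rule bij_betw_byWitness[where f' = "\<lambda>n. n(j := n j - c)"])
    (use assms in \<open>auto simp: lattice_def\<close>)

lemma finite_support_shift:
  assumes "finite {n \<in> lattice d. f n \<noteq> 0}" and "j < d"
  shows "finite {n \<in> lattice d. f (n(j := n j + c)) \<noteq> 0}"
proof (rule finite_imageD)
  have "(\<lambda>n. n(j := n j + c)) ` {n \<in> lattice d. f (n(j := n j + c)) \<noteq> 0}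
      \<subseteq> {n \<in> lattice d. f n \<noteq> 0}"
    using assms(2) by (auto simp: lattice_def)
  then show "finite ((\<lambda>n. n(j := n j + c)) ` {n \<in> lattice d. f (n(j := n j + c)) \<noteq> 0})"
    using assms(1) finite_subset by blast
  show "inj_on (\<lambda>n. n(j := n j + c)) {n \<in> lattice d. f (n(j := n j + c)) \<noteq> 0}"
    using bij_betw_shift_lattice[OF assms(2), of c]
    by (auto simp: bij_betw_def intro: inj_on_subset)
qed

lemma finitely_supported_laplacian:
  assumes "finitely_supported d u"
  shows "finitely_supported d (laplacian d u)"
proof -
  have "{n \<in> lattice d. laplacian d u n \<noteq> 0} \<subseteq> {n \<in> lattice d. u n \<noteq> 0} \<union>
      (\<Union>j<d. {n \<in> lattice d. u (n(j := n j + (-1))) \<noteq> 0} \<union> {n \<in> lattice d. u (n(j := n j + 1)) \<noteq> 0})"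
    unfolding laplacian_def by (auto intro!: sum.neutral)
  moreover have "finite \<dots>"
    using assms unfolding finitely_supported_def
    by (intro finite_UnI finite_UN_I finite_support_shift) auto
  ultimately show ?thesis
    unfolding finitely_supported_def by (rule finite_subset)
qed

lemma finitely_supported_iterate_laplacian:
  "finitely_supported d u \<Longrightarrow> finitely_supported d ((laplacian d ^^ i) u)"
  by (induction i) (auto intro: finitely_supported_laplacian)

text \<open>Translation by a multiple of a unit vector permutes the lattice, so each shift can be
  moved from \<open>P\<close> to \<open>W\<close> with the opposite sign. Only \<open>P\<close> has
  finite support: \<open>W\<close> will be a power of the weight, which vanishes nowhere.\<close>

lemma infsum_laplacian_symmetric:
  fixes W P :: "(nat \<Rightarrow> int) \<Rightarrow> real"
  assumes P: "finite {n \<in> lattice d. P n \<noteq> 0}"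
  shows "(\<lambda>n. W n * (\<Sum>j<d. 2 * P n - P (n(j := n j - 1)) - P (n(j := n j + 1)))) summable_on lattice d"
    and "(\<Sum>\<^sub>\<infinity>n\<in>lattice d. W n * (\<Sum>j<d. 2 * P n - P (n(j := n j - 1)) - P (n(j := n j + 1))))
    = (\<Sum>\<^sub>\<infinity>n\<in>lattice d. (\<Sum>j<d. 2 * W n - W (n(j := n j - 1)) - W (n(j := n j + 1))) * P n)"
proof -
  have mult: "(\<lambda>n. g n * f n) summable_on lattice d"
    if "finite {n \<in> lattice d. f n \<noteq> 0}" for f g :: "(nat \<Rightarrow> int) \<Rightarrow> real"
    by (rule finite_nonzero_values_imp_summable_on) (rule finite_subset[OF _ that], auto)
  have shift: "((\<lambda>n. W (n(j := n j - c)) * P n) has_sum (\<Sum>\<^sub>\<infinity>n\<in>lattice d. W n * P (n(j := n j + c)))) (lattice d)"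
    "((\<lambda>n. W n * P (n(j := n j + c))) has_sum (\<Sum>\<^sub>\<infinity>n\<in>lattice d. W n * P (n(j := n j + c)))) (lattice d)"
    if "j < d" for j c
  proof -
    show "((\<lambda>n. W n * P (n(j := n j + c))) has_sum (\<Sum>\<^sub>\<infinity>n\<in>lattice d. W n * P (n(j := n j + c)))) (lattice d)"
      by (intro has_sum_infsum mult finite_support_shift P that)
    then show "((\<lambda>n. W (n(j := n j - c)) * P n) has_sum (\<Sum>\<^sub>\<infinity>n\<in>lattice d. W n * P (n(j := n j + c)))) (lattice d)"
      using has_sum_reindex_bij_betw[OF bij_betw_shift_lattice[OF that, of "-c"], 
          of "\<lambda>n. W n * P (n(j := n j + c))"]
      by simp
  qed
  \<comment> \<open>The common value of both sums. Shifts are written \<open>+ (-1)\<close> to match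
    \<open>shift\<close> with \<open>c = -1\<close>; on the side of \<open>W\<close> the cases
    \<open>c = -1\<close> and \<open>c = 1\<close> exchange roles.\<close>
  define s where "s = (\<Sum>j<d. 2 * (\<Sum>\<^sub>\<infinity>n\<in>lattice d. W n * P n)
      - (\<Sum>\<^sub>\<infinity>n\<in>lattice d. W n * P (n(j := n j + (-1)))) - (\<Sum>\<^sub>\<infinity>n\<in>lattice d. W n * P (n(j := n j + 1))))"
  have diff: "((\<lambda>n. f n - g n) has_sum a - b) A" if "(f has_sum a) A" "(g has_sum b) A"
    for f g :: "(nat \<Rightarrow> int) \<Rightarrow> real" and a b A
    using has_sum_add[OF that(1), of "\<lambda>n. - g n" "- b"] that(2) by (simp add: has_sum_uminus)
  have WP: "((\<lambda>n. W n * P n) has_sum (\<Sum>\<^sub>\<infinity>n\<in>lattice d. W n * P n)) (lattice d)"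
    by (intro has_sum_infsum mult P)
  have "((\<lambda>n. \<Sum>j<d. 2 * (W n * P n) - W n * P (n(j := n j + (-1))) - W n * P (n(j := n j + 1))) has_sum s) (lattice d)"
    unfolding s_def
    by (intro has_sum_sum diff has_sum_cmult_right WP shift) auto
  moreover have "((\<lambda>n. \<Sum>j<d. 2 * (W n * P n) - W (n(j := n j - (-1))) * P n - W (n(j := n j - 1)) * P n) has_sum s) (lattice d)"
    unfolding s_def
    by (intro has_sum_sum diff has_sum_cmult_right WP shift) auto
  ultimately have "((\<lambda>n. W n * (\<Sum>j<d. 2 * P n - P (n(j := n j - 1)) - P (n(j := n j + 1)))) has_sum s) (lattice d)"
    and "((\<lambda>n. (\<Sum>j<d. 2 * W n - W (n(j := n j - 1)) - W (n(j := n j + 1))) * P n) has_sum s) (lattice d)"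
    by (simp_all add: sum_distrib_left sum_distrib_right algebra_simps)
  then show "(\<lambda>n. W n * (\<Sum>j<d. 2 * P n - P (n(j := n j - 1)) - P (n(j := n j + 1)))) summable_on lattice d"
    and "(\<Sum>\<^sub>\<infinity>n\<in>lattice d. W n * (\<Sum>j<d. 2 * P n - P (n(j := n j - 1)) - P (n(j := n j + 1))))
    = (\<Sum>\<^sub>\<infinity>n\<in>lattice d. (\<Sum>j<d. 2 * W n - W (n(j := n j - 1)) - W (n(j := n j + 1))) * P n)"
    by (auto simp: infsumI intro: has_sum_imp_summable)
qed

section \<open>One-variable estimates for inverse powers\<close>

text \<open>Taylor expansion with quadratic remainder, kept away from the pole at -1. Induction
  avoids derivatives: each step multiplies by the bound 1 - y + 2 y^2 for the first power.\<close>

lemma inverse_power_one_plus_le: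
  "\<exists>K\<ge>0. \<forall>y::real. \<bar>y\<bar> \<le> 1/2 \<longrightarrow> inverse (1 + y) ^ s \<le> 1 - real s * y + K * y\<^sup>2"
proof (induction s)
  case 0
  show ?case by (intro exI[of _ 0]) auto
next
  case (Suc s)
  then obtain K where K: "K \<ge> 0"
    and le: "\<And>y::real. \<bar>y\<bar> \<le> 1/2 \<Longrightarrow> inverse (1 + y) ^ s \<le> 1 - real s * y + K * y\<^sup>2"
    by blast
  \<comment> \<open>The quadratic remainder of the product has the factor s + K + 2 - (K + 2 s) y +
    2 K y^2. For |y| at most 1/2 it is at most s + K + 2 + (K + 2 s)/2 + K/2, which is
    \<open>M\<close>.\<close>
  define M where "M = 2 * s + 2 * K + 2"
  have "inverse (1 + y) ^ Suc s \<le> 1 - real (Suc s) * y + M * y\<^sup>2" if y: "\<bar>y\<bar> \<le> 1/2" for y :: real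
  proof -
    have pos: "1 + y \<ge> 1/2" using y by linarith
    \<comment> \<open>After multiplication by 1 + y, the next inequality reads 1 <= 1 + y^2 + 2 y^3,
      which is this one rearranged.\<close>
    have "y\<^sup>2 * (1 - 2 * (1 + y)) \<le> 0" using y by (intro mult_nonneg_nonpos) auto
    then have one: "inverse (1 + y) \<le> 1 - y + 2 * y\<^sup>2"
      using pos by (simp add: field_simps power2_eq_square power3_eq_cube)
    have "inverse (1 + y) ^ Suc s \<le> (1 - y + 2 * y\<^sup>2) * (1 - real s * y + K * y\<^sup>2)"
      unfolding power_Suc using one le[OF y] pos
      by (intro mult_mono) (auto intro: order_trans[rotated])
    also have "\<dots> = 1 - real (Suc s) * y + y\<^sup>2 * (s + K + 2 - (K + 2 * s) * y + 2 * K * y\<^sup>2)"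
      by (simp add: algebra_simps power2_eq_square)
    also have "\<dots> \<le> 1 - real (Suc s) * y + y\<^sup>2 * M"
    proof -
      have a: "(K + 2 * s) * (-y) \<le> (K + 2 * s) * (1/2)"
        using y K by (intro mult_left_mono) auto
      have "y\<^sup>2 \<le> (1/2)\<^sup>2" using y by (simp only: abs_le_square_iff[symmetric])
      then have "2 * K * y\<^sup>2 \<le> 2 * K * (1/4)"
        using K by (intro mult_left_mono) (auto simp: power2_eq_square)
      with a have "s + K + 2 - (K + 2 * s) * y + 2 * K * y\<^sup>2 \<le> M"
        unfolding M_def by (simp add: algebra_simps)
      then show ?thesis by (intro add_left_mono mult_left_mono) auto
    qed
    finally show ?thesis by (simp add: mult.commute)
  qed
  moreover have "M \<ge> 0" using K by (simp add: M_def)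
  ultimately show ?case by blast
qed

text \<open>With A = |n|^2 + 3 and x = n_j, the two neighbours in direction j have A + 1 - 2 x and A
  + 1 + 2 x in place of A. Factoring out A + 1 leaves 1 - y and 1 + y with y = 2 x / (A + 1): the
  linear Taylor terms cancel, and the quadratic ones give the error 8 K x^2. The gain comes from
  replacing A by A + 1.\<close>

lemma second_difference_inverse_power:
  "\<exists>K\<ge>0. \<forall>A x::real. A \<ge> 1 \<longrightarrow> 4 * \<bar>x\<bar> \<le> A + 1 \<longrightarrow>
     inverse A ^ Suc (Suc s) - K * x\<^sup>2 * inverse A ^ Suc (Suc (Suc s))
       \<le> 2 * inverse A ^ Suc s - inverse (A + 1 - 2 * x) ^ Suc s - inverse (A + 1 + 2 * x) ^ Suc s"
proof -
  obtain K where K: "K \<ge> 0"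
    and le: "\<And>y::real. \<bar>y\<bar> \<le> 1/2 \<Longrightarrow> inverse (1 + y) ^ Suc s \<le> 1 - real (Suc s) * y + K * y\<^sup>2"
    using inverse_power_one_plus_le[of "Suc s"] by blast
  have "inverse A ^ Suc (Suc s) - (8 * K) * x\<^sup>2 * inverse A ^ Suc (Suc (Suc s))
       \<le> 2 * inverse A ^ Suc s - inverse (A + 1 - 2 * x) ^ Suc s - inverse (A + 1 + 2 * x) ^ Suc s"
    if A: "A \<ge> 1" and x: "4 * \<bar>x\<bar> \<le> A + 1" for A x :: real
  proof -
    define y where "y = 2 * x / (A + 1)"
    have y: "\<bar>y\<bar> \<le> 1/2" using A x by (simp add: y_def field_simps)
    have eq: "A + 1 - 2 * x = (A + 1) * (1 + - y)" "A + 1 + 2 * x = (A + 1) * (1 + y)"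
      using A by (auto simp: y_def field_simps)
    have "inverse (A + 1 - 2 * x) ^ Suc s + inverse (A + 1 + 2 * x) ^ Suc s
        = inverse (A + 1) ^ Suc s * (inverse (1 + - y) ^ Suc s + inverse (1 + y) ^ Suc s)"
      unfolding eq by (simp only: inverse_mult_distrib power_mult_distrib ring_distribs(1)[of "inverse (A + 1) ^ Suc s"])
    also have "\<dots> \<le> inverse (A + 1) ^ Suc s * (2 + 2 * K * y\<^sup>2)"
      using le[of y] le[of "- y"] y A by (intro mult_left_mono) auto
    also have "\<dots> = 2 * inverse (A + 1) ^ Suc s + 8 * K * x\<^sup>2 * inverse (A + 1) ^ Suc (Suc (Suc s))"
      by (simp add: y_def divide_inverse algebra_simps power2_eq_square)
    also have "\<dots> \<le> (2 * inverse A ^ Suc s - inverse A ^ Suc (Suc s)) + 8 * K * x\<^sup>2 * inverse A ^ Suc (Suc (Suc s))"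
    proof (intro add_mono mult_left_mono)
      \<comment> \<open>One factor 1/(A + 1) is kept and the other \<open>s\<close> are enlarged to
        1/A. The kept factor yields the gain, because 2/A - 2/(A + 1) = 2/(A (A + 1)) is at least
        1/A^2 for A >= 1.\<close>
      have "inverse (A + 1) ^ Suc s \<le> inverse (A + 1) * inverse A ^ s"
        using A by (auto intro!: mult_left_mono power_mono le_imp_inverse_le)
      moreover have "2 * inverse (A + 1) \<le> 2 * inverse A - inverse A * inverse A"
        using A by (simp add: field_simps)
      then have "2 * inverse (A + 1) * inverse A ^ s \<le> (2 * inverse A - inverse A * inverse A) * inverse A ^ s"
        using A by (intro mult_right_mono) auto
      ultimately show "2 * inverse (A + 1) ^ Suc s \<le> 2 * inverse A ^ Suc s - inverse A ^ Suc (Suc s)"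
        by (simp add: algebra_simps)
      show "inverse (A + 1) ^ Suc (Suc (Suc s)) \<le> inverse A ^ Suc (Suc (Suc s))"
        using A by (intro power_mono le_imp_inverse_le) auto
    qed (use K in auto)
    finally show ?thesis by simp
  qed
  then show ?thesis using K by (intro exI[of _ "8 * K"]) auto
qed

section \<open>The weight and the Laplacian of its powers\<close>

text \<open>The shift keeps the weight finite at the origin. The value 3 gives A + 1 >= n_j^2 + 4 >=
  4 |n_j| for A = |n|^2 + 3, which is the condition in
  \<open>second_difference_inverse_power\<close>.\<close>

definition weight :: "nat \<Rightarrow> (nat \<Rightarrow> int) \<Rightarrow> real" where
  "weight d n = inverse ((lattice_norm d n)\<^sup>2 + 3)"

lemma weight_pos: "weight d n > 0"
  by (simp add: weight_def add_nonneg_pos)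

lemma lattice_norm_square: "(lattice_norm d n)\<^sup>2 = (\<Sum>i<d. (real_of_int (n i))\<^sup>2)"
  by (simp add: lattice_norm_def L2_set_def sum_nonneg)

lemma lattice_norm_shift_square:
  assumes "j < d"
  shows "(lattice_norm d (n(j := n j + c)))\<^sup>2
    = (lattice_norm d n)\<^sup>2 + 2 * real_of_int (c * n j) + (real_of_int c)\<^sup>2"
proof -
  have "(\<Sum>i<d. (real_of_int ((n(j := n j + c)) i))\<^sup>2)
      = (\<Sum>i<d. (real_of_int (n i))\<^sup>2 + (if i = j then 2 * real_of_int (c * n j) + (real_of_int c)\<^sup>2 else 0))"
    by (intro sum.cong) (auto simp: power2_eq_square algebra_simps)
  then show ?thesis
    using assms by (simp add: lattice_norm_square sum.distrib)
qed

text \<open>Every coordinate contributes the same gain, hence the factor d. The errors carry n_j^2,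
  which sums to |n|^2 < A, so their total is at most \<open>K\<close> times one gain, independently
  of d. From d >= 2 K on, half of the gain absorbs it.\<close>

lemma laplacian_weight_power_ge:
  "\<exists>N. \<forall>d\<ge>N. \<forall>n. real d / 2 * weight d n ^ Suc (Suc s)
     \<le> (\<Sum>j<d. 2 * weight d n ^ Suc s - weight d (n(j := n j - 1)) ^ Suc s - weight d (n(j := n j + 1)) ^ Suc s)"
proof -
  obtain K where K: "K \<ge> 0"
    and le: "\<And>A x::real. A \<ge> 1 \<Longrightarrow> 4 * \<bar>x\<bar> \<le> A + 1 \<Longrightarrow>
      inverse A ^ Suc (Suc s) - K * x\<^sup>2 * inverse A ^ Suc (Suc (Suc s))
       \<le> 2 * inverse A ^ Suc s - inverse (A + 1 - 2 * x) ^ Suc s - inverse (A + 1 + 2 * x) ^ Suc s"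
    using second_difference_inverse_power[of s] by blast
  have "real d / 2 * weight d n ^ Suc (Suc s)
     \<le> (\<Sum>j<d. 2 * weight d n ^ Suc s - weight d (n(j := n j - 1)) ^ Suc s - weight d (n(j := n j + 1)) ^ Suc s)"
    if d: "d \<ge> nat \<lceil>2 * K\<rceil>" for d n
  proof -
    define A where "A = (lattice_norm d n)\<^sup>2 + 3"
    have A: "A \<ge> 3" by (simp add: A_def)
    have w: "weight d n = inverse A" by (simp add: weight_def A_def)
    have "(\<Sum>j<d. inverse A ^ Suc (Suc s) - K * (real_of_int (n j))\<^sup>2 * inverse A ^ Suc (Suc (Suc s)))
        \<le> (\<Sum>j<d. 2 * weight d n ^ Suc s - weight d (n(j := n j - 1)) ^ Suc s - weight d (n(j := n j + 1)) ^ Suc s)"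
    proof (rule sum_mono)
      fix j assume "j \<in> {..<d}"
      then have j: "j < d" by simp
      define x where "x = real_of_int (n j)"
      have "x\<^sup>2 + 3 \<le> A"
        unfolding A_def lattice_norm_square x_def using j
        by (auto intro!: member_le_sum[of j "{..<d}" "\<lambda>i. (real_of_int (n i))\<^sup>2"])
      moreover have "0 \<le> (\<bar>x\<bar> - 2)\<^sup>2" by simp
      ultimately have "4 * \<bar>x\<bar> \<le> A + 1"
        by (simp add: power2_diff)
      moreover have "weight d (n(j := n j - 1)) = inverse (A + 1 - 2 * x)"
        "weight d (n(j := n j + 1)) = inverse (A + 1 + 2 * x)"
        using lattice_norm_shift_square[OF j, of n "-1"] lattice_norm_shift_square[OF j, of n 1]
        by (simp_all add: weight_def A_def x_def algebra_simps)
      ultimately show "inverse A ^ Suc (Suc s) - K * (real_of_int (n j))\<^sup>2 * inverse A ^ Suc (Suc (Suc s))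
        \<le> 2 * weight d n ^ Suc s - weight d (n(j := n j - 1)) ^ Suc s - weight d (n(j := n j + 1)) ^ Suc s"
        using le[of A x] A by (simp only: w x_def)
    qed
    moreover have "(\<Sum>j<d. inverse A ^ Suc (Suc s) - K * (real_of_int (n j))\<^sup>2 * inverse A ^ Suc (Suc (Suc s)))
        = real d * inverse A ^ Suc (Suc s) - K * (A - 3) * inverse A * inverse A ^ Suc (Suc s)"
      unfolding A_def lattice_norm_square
      by (simp add: sum_subtractf sum_distrib_left sum_distrib_right mult_ac)
    moreover have "K * (A - 3) * inverse A * inverse A ^ Suc (Suc s) \<le> real d / 2 * inverse A ^ Suc (Suc s)"
    proof (rule mult_right_mono)
      have "K * (A - 3) * inverse A \<le> K" using A K by (simp add: field_simps)
      also have "K \<le> real d / 2" using d by linarith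
      finally show "K * (A - 3) * inverse A \<le> real d / 2" .
    qed (use A in auto)
    ultimately show ?thesis unfolding w by simp
  qed
  then show ?thesis by blast
qed

section \<open>Weighted energies and the iterated lower estimate\<close>

text \<open>The squared norm of w^i v for the weight w. For \<open>i = 0\<close> it is the
  unweighted sum on the left of the Hardy-Rellich inequality.\<close>

definition weighted_energy :: "nat \<Rightarrow> nat \<Rightarrow> ((nat \<Rightarrow> int) \<Rightarrow> complex) \<Rightarrow> real" where
  "weighted_energy d i v = (\<Sum>\<^sub>\<infinity>n\<in>lattice d. weight d n ^ (2 * i) * (cmod (v n))\<^sup>2)"

lemma finite_support_imp_summable_on:
  assumes "finitely_supported d v" and "\<And>n. v n = 0 \<Longrightarrow> f n = 0"
  shows "f summable_on lattice d"
  using assms unfolding finitely_supported_def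
  by (intro finite_nonzero_values_imp_summable_on) (auto elim: rev_finite_subset)

text \<open>Summation by parts gives (d/2) X <= (d/4) X + (4/d) Y, where \<open>X\<close> and
  \<open>Y\<close> are the two energies. Cancelling (d/4) X and multiplying by d/4 gives the
  constant d^2/16.\<close>

lemma weighted_energy_laplacian_ge:
  "\<exists>N. \<forall>d\<ge>N. \<forall>v. finitely_supported d v \<longrightarrow>
     (real d)\<^sup>2 / 16 * weighted_energy d (Suc i) v \<le> weighted_energy d i (laplacian d v)"
proof -
  obtain N where N: "\<And>d n. d \<ge> N \<Longrightarrow> real d / 2 * weight d n ^ Suc (Suc (2 * i))
     \<le> (\<Sum>j<d. 2 * weight d n ^ Suc (2 * i) - weight d (n(j := n j - 1)) ^ Suc (2 * i)
            - weight d (n(j := n j + 1)) ^ Suc (2 * i))"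
    using laplacian_weight_power_ge[of "2 * i"] by blast
  have "(real d)\<^sup>2 / 16 * weighted_energy d (Suc i) v \<le> weighted_energy d i (laplacian d v)"
    if d: "d \<ge> N" "d \<ge> 1" and v: "finitely_supported d v" for d v
  proof -
    note summable = finite_support_imp_summable_on[OF v] finite_support_imp_summable_on[OF finitely_supported_laplacian[OF v]]
    define W where "W n = weight d n ^ Suc (2 * i)" for n
    define P where "P n = (cmod (v n))\<^sup>2" for n
    define X where "X = weighted_energy d (Suc i) v"
    define Y where "Y = weighted_energy d i (laplacian d v)"
    define lapP where "lapP n = (\<Sum>j<d. 2 * P n - P (n(j := n j - 1)) - P (n(j := n j + 1)))" for n
    define lapW where "lapW n = (\<Sum>j<d. 2 * W n - W (n(j := n j - 1)) - W (n(j := n j + 1)))" for n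
    have P: "finite {n \<in> lattice d. P n \<noteq> 0}"
      using v by (simp add: P_def finitely_supported_def)
    have lapP_summable: "(\<lambda>n. W n * lapP n) summable_on lattice d"
      unfolding lapP_def by (rule infsum_laplacian_symmetric(1)[OF P])
    have pointwise: "W n * lapP n \<le> real d / 4 * (weight d n ^ (2 * Suc i) * (cmod (v n))\<^sup>2)
        + 4 / real d * (weight d n ^ (2 * i) * (cmod (laplacian d v n))\<^sup>2)" for n
    proof -
      define D where "D = laplacian d v n"
      \<comment> \<open>The Laplacian of |v|^2 is bounded by 2 Re(cnj v * Laplacian of v), since
        each mixed term 2 Re(cnj a * b) is at most |a|^2 + |b|^2.\<close>
      have "lapP n \<le> (\<Sum>j<d. 2 * Re (cnj (v n) * (2 * v n - v (n(j := n j - 1)) - v (n(j := n j + 1)))))"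
        unfolding lapP_def
      proof (rule sum_mono)
        fix j
        have "2 * Re (cnj a * b) \<le> (cmod a)\<^sup>2 + (cmod b)\<^sup>2" for a b :: complex
          using zero_le_power2[of "Re a - Re b"] zero_le_power2[of "Im a - Im b"]
          unfolding cmod_power2 by (simp add: power2_eq_square algebra_simps)
        from this[of "v n" "v (n(j := n j - 1))"] this[of "v n" "v (n(j := n j + 1))"]
        show "2 * P n - P (n(j := n j - 1)) - P (n(j := n j + 1))
            \<le> 2 * Re (cnj (v n) * (2 * v n - v (n(j := n j - 1)) - v (n(j := n j + 1))))"
          unfolding P_def cmod_power2 by (simp add: power2_eq_square algebra_simps)
      qed
      also have "\<dots> = 2 * Re (cnj (v n) * D)"
        by (simp only: D_def laplacian_def sum_distrib_left Re_sum)
      also have "\<dots> \<le> 2 * cmod (v n) * cmod D"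
        using complex_Re_le_cmod[of "cnj (v n) * D"] by (simp add: norm_mult)
      finally have "W n * lapP n \<le> W n * (2 * cmod (v n) * cmod D)"
        using weight_pos[of d n] by (intro mult_left_mono) (auto simp: W_def)
      also have "\<dots> = weight d n ^ (2 * i) * (2 * (weight d n * cmod (v n)) * cmod D)"
        by (simp add: W_def)
      also have "\<dots> \<le> weight d n ^ (2 * i) * (real d / 4 * (weight d n * cmod (v n))\<^sup>2 + 4 / real d * (cmod D)\<^sup>2)"
      proof (rule mult_left_mono)
        \<comment> \<open>Young's inequality 2 a b <= t a^2 + b^2/t. The choice t = d/4 spends half
          of the available (d/2) X.\<close>
        have "0 \<le> (real d / 4 * a - b)\<^sup>2 * (4 / real d)" for a b :: real by simp
        moreover have "(real d / 4 * a - b)\<^sup>2 * (4 / real d) = real d / 4 * a\<^sup>2 + 4 / real d * b\<^sup>2 - 2 * a * b"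
          for a b :: real
          using d by (simp add: field_simps power2_eq_square)
        ultimately show "2 * (weight d n * cmod (v n)) * cmod D
            \<le> real d / 4 * (weight d n * cmod (v n))\<^sup>2 + 4 / real d * (cmod D)\<^sup>2"
          by (metis diff_ge_0_iff_ge)
      qed (use weight_pos[of d n] in auto)
      finally show ?thesis
        by (simp add: D_def algebra_simps power2_eq_square)
    qed
    have "real d / 2 * X = (\<Sum>\<^sub>\<infinity>n\<in>lattice d. real d / 2 * weight d n ^ (2 * Suc i) * P n)"
      by (simp add: X_def weighted_energy_def P_def infsum_cmult_right'[symmetric] mult_ac)
    also have "\<dots> \<le> (\<Sum>\<^sub>\<infinity>n\<in>lattice d. lapW n * P n)"
    proof (rule infsum_mono)
      show "real d / 2 * weight d n ^ (2 * Suc i) * P n \<le> lapW n * P n" for n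
        using N[OF d(1), of n] by (intro mult_right_mono) (auto simp: lapW_def W_def P_def)
    qed (auto intro!: summable(1) simp: P_def)
    also have "\<dots> = (\<Sum>\<^sub>\<infinity>n\<in>lattice d. W n * lapP n)"
      unfolding lapW_def lapP_def using infsum_laplacian_symmetric(2)[OF P, of W] by simp
    also have "\<dots> \<le> (\<Sum>\<^sub>\<infinity>n\<in>lattice d. real d / 4 * (weight d n ^ (2 * Suc i) * (cmod (v n))\<^sup>2)
        + 4 / real d * (weight d n ^ (2 * i) * (cmod (laplacian d v n))\<^sup>2))"
      by (intro infsum_mono lapP_summable pointwise summable_on_add summable_on_cmult_right summable) auto
    also have "\<dots> = real d / 4 * X + 4 / real d * Y"
    proof -
      have "(\<lambda>n. weight d n ^ (2 * Suc i) * (cmod (v n))\<^sup>2) summable_on lattice d"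
        by (rule summable(1)) simp
      moreover have "(\<lambda>n. weight d n ^ (2 * i) * (cmod (laplacian d v n))\<^sup>2) summable_on lattice d"
        by (rule summable(2)) simp
      ultimately show ?thesis
        unfolding X_def Y_def weighted_energy_def
        by (simp only: infsum_add[OF summable_on_cmult_right summable_on_cmult_right] infsum_cmult_right')
    qed
    finally show ?thesis
      using d unfolding X_def[symmetric] Y_def[symmetric] by (simp add: field_simps power2_eq_square)
  qed
  then show ?thesis by (intro exI[of _ "max N 1"]) auto
qed

text \<open>The one-step estimate trades one Laplacian for one power of the weight. The induction
  hypothesis is then applied to \<open>laplacian d v\<close>, which need not vanish at the origin;
  finite support suffices. The threshold for d grows with \<open>k\<close> through a
  maximum.\<close>

lemma weighted_energy_iterate_laplacian_ge:
  "\<exists>N. \<forall>d\<ge>N. \<forall>v. finitely_supported d v \<longrightarrow>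
     ((real d)\<^sup>2 / 16) ^ k * weighted_energy d k v \<le> weighted_energy d 0 ((laplacian d ^^ k) v)"
proof (induction k)
  case 0
  show ?case by simp
next
  case (Suc k)
  then obtain N where N: "\<And>d v. d \<ge> N \<Longrightarrow> finitely_supported d v \<Longrightarrow>
      ((real d)\<^sup>2 / 16) ^ k * weighted_energy d k v \<le> weighted_energy d 0 ((laplacian d ^^ k) v)"
    by blast
  obtain M where M: "\<And>d v. d \<ge> M \<Longrightarrow> finitely_supported d v \<Longrightarrow>
      (real d)\<^sup>2 / 16 * weighted_energy d (Suc k) v \<le> weighted_energy d k (laplacian d v)"
    using weighted_energy_laplacian_ge[of k] by blast
  have "((real d)\<^sup>2 / 16) ^ Suc k * weighted_energy d (Suc k) v \<le> weighted_energy d 0 ((laplacian d ^^ Suc k) v)"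
    if d: "d \<ge> max N M" and v: "finitely_supported d v" for d v
  proof -
    have "((real d)\<^sup>2 / 16) ^ Suc k * weighted_energy d (Suc k) v
        = ((real d)\<^sup>2 / 16) ^ k * ((real d)\<^sup>2 / 16 * weighted_energy d (Suc k) v)"
      by simp
    also have "\<dots> \<le> ((real d)\<^sup>2 / 16) ^ k * weighted_energy d k (laplacian d v)"
      using M d v by (intro mult_left_mono) auto
    also have "\<dots> \<le> weighted_energy d 0 ((laplacian d ^^ k) (laplacian d v))"
      using N d v finitely_supported_laplacian by simp
    finally show ?thesis by (simp add: funpow_swap1)
  qed
  then show ?case by blast
qed

section \<open>Norm bound for the Laplacian\<close>

text \<open>Cauchy-Schwarz over the d directions costs a factor d, and over the four values in each
  second difference a factor 4. All translates of |v|^2 have the same sum, so the d directions with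
  total weight 4 each give 4 d * 4 d = 16 d^2.\<close>

lemma energy_laplacian_le:
  assumes v: "finitely_supported d v"
  shows "weighted_energy d 0 (laplacian d v) \<le> 16 * (real d)\<^sup>2 * weighted_energy d 0 v"
proof -
  define P where "P n = (cmod (v n))\<^sup>2" for n
  define Q where "Q n = 4 * real d * (\<Sum>j<d. 2 * P n + P (n(j := n j + (-1))) + P (n(j := n j + 1)))" for n
  have P: "(P has_sum weighted_energy d 0 v) (lattice d)"
    using finite_support_imp_summable_on[OF v, of P]
    by (simp add: P_def[abs_def] weighted_energy_def summable_iff_has_sum_infsum)
  have shift: "((\<lambda>n. P (n(j := n j + c))) has_sum weighted_energy d 0 v) (lattice d)" if "j < d" for j c
    using P has_sum_reindex_bij_betw[OF bij_betw_shift_lattice[OF that]] by blast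
  have "(Q has_sum 4 * real d * (\<Sum>j<d. 2 * weighted_energy d 0 v + weighted_energy d 0 v + weighted_energy d 0 v)) (lattice d)"
    unfolding Q_def by (intro has_sum_cmult_right has_sum_sum has_sum_add P shift) auto
  then have Q: "(Q has_sum 16 * (real d)\<^sup>2 * weighted_energy d 0 v) (lattice d)"
    by (simp add: power2_eq_square mult_ac)
  have pointwise: "weight d n ^ (2 * 0) * (cmod (laplacian d v n))\<^sup>2 \<le> Q n" for n
  proof -
    let ?b = "\<lambda>j. cmod (2 * v n - v (n(j := n j - 1)) - v (n(j := n j + 1)))"
    have "cmod (laplacian d v n) \<le> (\<Sum>j<d. ?b j)"
      unfolding laplacian_def by (rule norm_sum)
    then have "(cmod (laplacian d v n))\<^sup>2 \<le> (\<Sum>j<d. ?b j)\<^sup>2"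
      by (intro power_mono) auto
    also have "\<dots> \<le> real d * (\<Sum>j<d. (?b j)\<^sup>2)"
      using sum_squared_le_sum_of_squares[of ?b "{..<d}"] by (simp add: mult.commute)
    also have "\<dots> \<le> real d * (\<Sum>j<d. 4 * (2 * P n + P (n(j := n j + (-1))) + P (n(j := n j + 1))))"
    proof (intro mult_left_mono sum_mono)
      fix j
      let ?x = "cmod (v n)" and ?y = "cmod (v (n(j := n j - 1)))" and ?z = "cmod (v (n(j := n j + 1)))"
      have "?b j \<le> 2 * ?x + ?y + ?z"
        using norm_triangle_ineq4[of "2 * v n - v (n(j := n j - 1))" "v (n(j := n j + 1))"]
          norm_triangle_ineq4[of "2 * v n" "v (n(j := n j - 1))"]
        by (simp add: norm_mult)
      then have "(?b j)\<^sup>2 \<le> (2 * ?x + ?y + ?z)\<^sup>2"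
        by (intro power_mono) auto
      \<comment> \<open>The left side is the square of a sum of four terms, with ?x counted twice;
        the list enumerates them.\<close>
      also have "\<dots> \<le> 4 * (2 * ?x\<^sup>2 + ?y\<^sup>2 + ?z\<^sup>2)"
        using sum_squared_le_sum_of_squares[of "\<lambda>i. [?x, ?x, ?y, ?z] ! i" "{..<4}"]
        by (simp add: numeral_eq_Suc)
      finally show "(?b j)\<^sup>2 \<le> 4 * (2 * P n + P (n(j := n j + (-1))) + P (n(j := n j + 1)))"
        by (simp add: P_def)
    qed auto
    also have "\<dots> = Q n"
      by (simp only: Q_def sum_distrib_left[symmetric] mult.assoc mult.left_commute[of "real d"])
    finally show ?thesis by simp
  qed
  have "weighted_energy d 0 (laplacian d v) \<le> infsum Q (lattice d)"
    unfolding weighted_energy_def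
    by (rule infsum_mono[OF finite_support_imp_summable_on[OF finitely_supported_laplacian[OF v]]
          has_sum_imp_summable[OF Q] pointwise]) simp
  then show ?thesis using Q by (simp add: infsumI)
qed

lemma energy_iterate_laplacian_le:
  assumes "finitely_supported d v"
  shows "weighted_energy d 0 ((laplacian d ^^ k) v) \<le> (16 * (real d)\<^sup>2) ^ k * weighted_energy d 0 v"
proof (induction k)
  case (Suc k)
  have "weighted_energy d 0 ((laplacian d ^^ Suc k) v)
      \<le> 16 * (real d)\<^sup>2 * weighted_energy d 0 ((laplacian d ^^ k) v)"
    using energy_laplacian_le[OF finitely_supported_iterate_laplacian[OF assms]] by simp
  also have "\<dots> \<le> 16 * (real d)\<^sup>2 * ((16 * (real d)\<^sup>2) ^ k * weighted_energy d 0 v)"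
    using Suc by (intro mult_left_mono) auto
  finally show ?case by (simp add: mult_ac)
qed simp

section \<open>Comparison with the Hardy weight and bounds for the sharp constant\<close>

text \<open>A nonzero integer point has |n|^2 >= 1, hence |n|^2 + 3 <= 4 |n|^2. Raising to the power
  2 k turns the factor 4 into 16^k.\<close>

lemma hardy_weight_le:
  assumes "n \<in> lattice d" and "n \<noteq> (\<lambda>_. 0)"
  shows "1 / lattice_norm d n ^ (4 * k) \<le> 16 ^ k * weight d n ^ (2 * k)"
proof -
  obtain j where j: "n j \<noteq> 0" using assms(2) by blast
  then have "j < d" using assms(1) by (auto simp: lattice_def not_less[symmetric])
  have "1 \<le> \<bar>real_of_int (n j)\<bar>" using j by linarith
  then have "1 \<le> (real_of_int (n j))\<^sup>2"
    using abs_le_square_iff[of 1 "real_of_int (n j)"] by simp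
  also have "\<dots> \<le> (lattice_norm d n)\<^sup>2"
    unfolding lattice_norm_square using \<open>j < d\<close>
    by (auto intro!: member_le_sum[of j "{..<d}" "\<lambda>i. (real_of_int (n i))\<^sup>2"])
  finally have "1 \<le> (lattice_norm d n)\<^sup>2" .
  moreover have "inverse q \<le> 4 * inverse (q + 3)" if "1 \<le> q" for q :: real
    using that by (simp add: field_simps)
  ultimately have "inverse ((lattice_norm d n)\<^sup>2) \<le> 4 * weight d n"
    by (simp add: weight_def)
  then have "inverse ((lattice_norm d n)\<^sup>2) ^ (2 * k) \<le> (4 * weight d n) ^ (2 * k)"
    by (intro power_mono) auto
  moreover have "inverse ((lattice_norm d n)\<^sup>2) ^ (2 * k) = 1 / lattice_norm d n ^ (4 * k)"
    by (simp add: inverse_eq_divide power_divide flip: power_mult)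
  ultimately show ?thesis
    by (simp add: power_mult_distrib power_mult)
qed

lemma sharp_constant_le:
  assumes "d \<ge> 1"
  shows "sharp_constant k d \<le> 16 ^ k * real d ^ (2 * k)"
proof -
  \<comment> \<open>The first unit vector, written as a shift of the origin so that
    \<open>lattice_norm_shift_square\<close> computes its norm.\<close>
  define e :: "nat \<Rightarrow> int" where "e = (\<lambda>_. 0)(0 := 1)"
  define u :: "(nat \<Rightarrow> int) \<Rightarrow> complex" where "u = (\<lambda>n. if n = e then 1 else 0)"
  have e: "e \<in> lattice d" using assms by (auto simp: e_def lattice_def)
  have "(lattice_norm d e)\<^sup>2 = 1"
    using lattice_norm_shift_square[of 0 d "\<lambda>_. 0" 1] assms by (simp add: e_def lattice_norm_square)
  moreover have "lattice_norm d e \<ge> 0"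
    by (simp add: lattice_norm_def L2_set_nonneg)
  ultimately have norm_e: "lattice_norm d e = 1"
    by (auto simp: power2_eq_1_iff)
  have supp: "finitely_supported d u"
    by (simp add: finitely_supported_def u_def)
  have u0: "u (\<lambda>_. 0) = 0"
    by (auto simp: u_def e_def fun_eq_iff)
  have single: "(\<Sum>\<^sub>\<infinity>n\<in>lattice d. f n) = f e" if "\<And>n. n \<noteq> e \<Longrightarrow> f n = 0" for f :: "(nat \<Rightarrow> int) \<Rightarrow> real"
    using infsum_cong_neutral[of "{e}" "lattice d" f f] that e by auto
  have "(\<Sum>\<^sub>\<infinity>n\<in>lattice d. (cmod (u n))\<^sup>2 / lattice_norm d n ^ (4 * k)) = 1"
    by (subst single) (auto simp: u_def norm_e)
  then have "sharp_constant k d \<le> weighted_energy d 0 ((laplacian d ^^ k) u)"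
    using sharp_constant_greatest(1)[OF assms, of k] supp u0
    unfolding hardy_rellich_def weighted_energy_def by fastforce
  also have "\<dots> \<le> (16 * (real d)\<^sup>2) ^ k * weighted_energy d 0 u"
    by (rule energy_iterate_laplacian_le[OF supp])
  also have "weighted_energy d 0 u = 1"
    unfolding weighted_energy_def by (subst single) (auto simp: u_def)
  finally show ?thesis by (simp add: power_mult_distrib power_mult)
qed

lemma hardy_rellich_of_weighted_energy:
  assumes "c \<ge> 0"
    and "\<And>v. finitely_supported d v \<Longrightarrow> c * weighted_energy d k v \<le> weighted_energy d 0 ((laplacian d ^^ k) v)"
  shows "hardy_rellich k d (c / 16 ^ k)"
  unfolding hardy_rellich_def
proof (intro allI impI)
  fix u assume u: "finitely_supported d u \<and> u (\<lambda>_. 0) = 0"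
  note summable = finite_support_imp_summable_on[OF conjunct1[OF u]]
  have "(\<Sum>\<^sub>\<infinity>n\<in>lattice d. (cmod (u n))\<^sup>2 / lattice_norm d n ^ (4 * k))
      \<le> (\<Sum>\<^sub>\<infinity>n\<in>lattice d. 16 ^ k * (weight d n ^ (2 * k) * (cmod (u n))\<^sup>2))"
  proof (rule infsum_mono)
    fix n assume n: "n \<in> lattice d"
    show "(cmod (u n))\<^sup>2 / lattice_norm d n ^ (4 * k) \<le> 16 ^ k * (weight d n ^ (2 * k) * (cmod (u n))\<^sup>2)"
    \<comment> \<open>At the origin, which \<open>hardy_weight_le\<close> excludes, both sides are 0
      because \<open>u\<close> vanishes there.\<close>
    proof (cases "n = (\<lambda>_. 0)")
      case False
      from mult_right_mono[OF hardy_weight_le[OF n this, of k], of "(cmod (u n))\<^sup>2"]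
      show ?thesis by (simp add: mult.assoc)
    qed (use u in simp)
  qed (auto intro!: summable)
  also have "\<dots> = 16 ^ k * weighted_energy d k u"
    by (simp add: weighted_energy_def infsum_cmult_right')
  finally have "c / 16 ^ k * (\<Sum>\<^sub>\<infinity>n\<in>lattice d. (cmod (u n))\<^sup>2 / lattice_norm d n ^ (4 * k))
      \<le> c / 16 ^ k * (16 ^ k * weighted_energy d k u)"
    using assms(1) by (intro mult_left_mono) auto
  also have "\<dots> \<le> weighted_energy d 0 ((laplacian d ^^ k) u)"
    using assms(2) u by simp
  finally show "c / 16 ^ k * (\<Sum>\<^sub>\<infinity>n\<in>lattice d. (cmod (u n))\<^sup>2 / lattice_norm d n ^ (4 * k))
      \<le> (\<Sum>\<^sub>\<infinity>n\<in>lattice d. (cmod ((laplacian d ^^ k) u n))\<^sup>2)"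
    by (simp add: weighted_energy_def)
qed

theorem theorem3p3:
  fixes k :: nat
  assumes "k \<ge> 1"
  shows "\<exists>c1>0. \<exists>c2>0. \<exists>N>0. \<forall>d\<ge>N.
           c1 * real d ^ (2 * k) \<le> sharp_constant k d \<and>
           sharp_constant k d \<le> c2 * real d ^ (2 * k)"
proof -
  obtain N where N: "\<And>d v. d \<ge> N \<Longrightarrow> finitely_supported d v \<Longrightarrow>
      ((real d)\<^sup>2 / 16) ^ k * weighted_energy d k v \<le> weighted_energy d 0 ((laplacian d ^^ k) v)"
    using weighted_energy_iterate_laplacian_ge[of k] by blast
  \<comment> \<open>One factor 16^k in 256^k comes from the iterated estimate, the other from
    comparing the weights. The maximum with 1 ensures that the greatest constant exists.\<close>
  have "1 / 256 ^ k * real d ^ (2 * k) \<le> sharp_constant k d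
      \<and> sharp_constant k d \<le> 16 ^ k * real d ^ (2 * k)" if d: "d \<ge> max N 1" for d
  proof
    have "hardy_rellich k d (((real d)\<^sup>2 / 16) ^ k / 16 ^ k)"
      using N d by (intro hardy_rellich_of_weighted_energy) auto
    moreover have "((real d)\<^sup>2 / 16) ^ k / 16 ^ k = 1 / 256 ^ k * real d ^ (2 * k)"
      by (simp add: power_divide power_mult power_mult_distrib[symmetric])
    ultimately show "1 / 256 ^ k * real d ^ (2 * k) \<le> sharp_constant k d"
      using sharp_constant_greatest(2)[of d k] d by simp
    show "sharp_constant k d \<le> 16 ^ k * real d ^ (2 * k)"
      using sharp_constant_le d by simp
  qed
  then show ?thesis
    by (intro exI[of _ "1 / 256 ^ k :: real"] exI[of _ "16 ^ k :: real"] exI[of _ "max N 1"] conjI) auto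
qed

end
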